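(* Let $(\{s_i\}_{i=1,\dots,n},k,d)$ be an instance of \textsc{Minimax Approval Voting} with $s_i\in\{0,1\}^m$, let $\epsilon\in(0,3)$, and consider the randomized algorithm below. Assume there is a solution $s^*\in S_{k,m}$ (i.e. $\mathrm{H}(s^*,s_i)\le d$ for all $i$) and that the algorithm created a string $x_j$, for some $j\in\{0,\dots,d\}$. Then \[\Pr\left[\mathrm{H}(x_j,s^* )\le 2d-2j\right]\ge\left(\tfrac{\epsilon}{3}\right)^{2j}.\] The algorithm: if $|\mathrm{ones}(s_1)-k|>d$, return NO. Let $x_0$ be any $k$-completion of $s_1$. For $j=1,\dots,d$: if $\max_i\mathrm{H}(x_{j-1},s_i)\le(1+\epsilon)d$, return $x_{j-1}$; otherwise fix any $i$ with $\mathrm{H}(x_{j-1},s_i)>(1+\epsilon)d$, let $P_{j,0}=\{a\in[m]: x_{j-1}[a]=0,\ s_i[a]=1\}$ and $P_{j,1}=\{a\in[m]: x_{j-1}[a]=1,\ s_i[a]=0\}$; if $\min(|P_{j,0}|,|P_{j,1}|)=0$ return NO; otherwise choose $a_0\in P_{j,0}$ and $a_1\in P_{j,1}$ uniformly at random and obtain $x_j$ from $x_{j-1}$ by setting position $a_0$ to $1$ and position $a_1$ to $0$. After the loop, return $x_d$ if $\max_i\mathrm{H}(x_d,s_i)\le(1+\epsilon)d$, and NO otherwise.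
   Context: $[m]=\{1,\dots,m\}$; $s[a]$ is the $a$-th letter of $s$; $\mathrm{H}$ is Hamming distance; $\mathrm{ones}(s)$ is the number of $1$'s in $s$; $S_{k,m}$ is the set of strings in $\{0,1\}^m$ with exactly $k$ ones. A $k$-completion of $s\in\{0,1\}^m$ is any string $s'\in S_{k,m}$ with $\mathrm{H}(s,s')=|\mathrm{ones}(s)-k|$. \textsc{Minimax Approval Voting}: given a multiset $\{s_1,\dots,s_n\}\subseteq\{0,1\}^m$ and integers $k,d$, decide whether there is $s\in S_{k,m}$ with $\mathrm{H}(s,s_i)\le d$ for all $i$.
   Formalization: The assumption that x_j was created is placed inside the event: the bound is proved for Pr[if x_j is created then H(x_j,s* ) ≤ 2d−2j], so runs that stop earlier count as successes; conditioning on creation of x_j makes the claim false, since good runs may return early. *)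

theory Defs
  imports "HOL-Probability.Probability"
begin

text \<open>A string in \<open>{0,1}\<^sup>m\<close> is a \<^typ>\<open>bool list\<close> of length \<open>m\<close>, with \<^const>\<open>True\<close> for the
  letter 1. Positions are numbered from 0.\<close>

definition hamming :: "bool list \<Rightarrow> bool list \<Rightarrow> nat" where
  "hamming s t = card {a. a < length s \<and> s ! a \<noteq> t ! a}"

definition ones :: "bool list \<Rightarrow> nat" where
  "ones s = card {a. a < length s \<and> s ! a}"

definition S :: "nat \<Rightarrow> nat \<Rightarrow> bool list set" where
  "S k m = {s. length s = m \<and> ones s = k}"

definition k_completion :: "nat \<Rightarrow> bool list \<Rightarrow> bool list \<Rightarrow> bool" where
  "k_completion k s s' \<longleftrightarrow>
     s' \<in> S k (length s) \<and> int (hamming s s') = \<bar>int (ones s) - int k\<bar>"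

definition mav_solution ::
  "nat \<Rightarrow> nat \<Rightarrow> (nat \<Rightarrow> bool list) \<Rightarrow> nat \<Rightarrow> nat \<Rightarrow> bool list \<Rightarrow> bool" where
  "mav_solution m n s k d t \<longleftrightarrow> t \<in> S k m \<and> (\<forall>i\<in>{1..n}. hamming t (s i) \<le> d)"

datatype answer = NO | Return "bool list"

text \<open>A run is the list of all strings \<open>x\<^sub>0, x\<^sub>1, \<dots>\<close> that were created, together with the answer.\<close>

type_synonym run = "bool list list \<times> answer"

definition created :: "run \<Rightarrow> nat \<Rightarrow> bool" where
  "created r j \<longleftrightarrow> j < length (fst r)"

definition created_string :: "run \<Rightarrow> nat \<Rightarrow> bool list" where
  "created_string r j = fst r ! j"

definition good_approx ::
  "nat \<Rightarrow> (nat \<Rightarrow> bool list) \<Rightarrow> nat \<Rightarrow> real \<Rightarrow> bool list \<Rightarrow> bool" where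
  "good_approx n s d \<epsilon> x \<longleftrightarrow> real (MAX i\<in>{1..n}. hamming x (s i)) \<le> (1 + \<epsilon>) * real d"

definition P0 :: "bool list \<Rightarrow> bool list \<Rightarrow> nat set" where
  "P0 x t = {a. a < length x \<and> \<not> x ! a \<and> t ! a}"

definition P1 :: "bool list \<Rightarrow> bool list \<Rightarrow> nat set" where
  "P1 x t = {a. a < length x \<and> x ! a \<and> \<not> t ! a}"

text \<open>The choice of a violated index (``fix any \<open>i\<close>'') is a function of all strings created so far,
  so it may depend on the iteration and on the previous random choices.\<close>

definition valid_selection ::
  "nat \<Rightarrow> (nat \<Rightarrow> bool list) \<Rightarrow> nat \<Rightarrow> real \<Rightarrow> (bool list list \<Rightarrow> nat) \<Rightarrow> bool" where
  "valid_selection n s d \<epsilon> sel \<longleftrightarrow>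
     (\<forall>xs. xs \<noteq> [] \<and> (\<exists>i\<in>{1..n}. real (hamming (last xs) (s i)) > (1 + \<epsilon>) * real d) \<longrightarrow>
        sel xs \<in> {1..n} \<and> real (hamming (last xs) (s (sel xs))) > (1 + \<epsilon>) * real d)"

text \<open>\<open>mav_loop n s d \<epsilon> sel r xs\<close>: \<open>r\<close> iterations remain, \<open>xs\<close> are the strings created so far.\<close>

primrec mav_loop ::
  "nat \<Rightarrow> (nat \<Rightarrow> bool list) \<Rightarrow> nat \<Rightarrow> real \<Rightarrow> (bool list list \<Rightarrow> nat) \<Rightarrow>
   nat \<Rightarrow> bool list list \<Rightarrow> run pmf" where
  "mav_loop n s d \<epsilon> sel 0 xs =
     return_pmf (xs, if good_approx n s d \<epsilon> (last xs) then Return (last xs) else NO)"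
| "mav_loop n s d \<epsilon> sel (Suc r) xs =
     (let x = last xs; t = s (sel xs) in
      if good_approx n s d \<epsilon> x then return_pmf (xs, Return x)
      else if min (card (P0 x t)) (card (P1 x t)) = 0 then return_pmf (xs, NO)
      else bind_pmf (pmf_of_set (P0 x t)) (\<lambda>a0.
           bind_pmf (pmf_of_set (P1 x t)) (\<lambda>a1.
             mav_loop n s d \<epsilon> sel r (xs @ [x[a0 := True, a1 := False]]))))"

definition mav_algorithm ::
  "nat \<Rightarrow> (nat \<Rightarrow> bool list) \<Rightarrow> nat \<Rightarrow> nat \<Rightarrow> real \<Rightarrow> bool list \<Rightarrow>
   (bool list list \<Rightarrow> nat) \<Rightarrow> run pmf" where
  "mav_algorithm n s k d \<epsilon> x0 sel =
     (if \<bar>int (ones (s 1)) - int k\<bar> > int d then return_pmf ([], NO)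
      else mav_loop n s d \<epsilon> sel d [x0])"

end

theory Submission
  imports Defs
begin

text \<open>Let \<open>x\<close> and \<open>u\<close> have equally many ones and let \<open>h = H(x,t)\<close>, \<open>\<delta> = h - H(u,t) > 0\<close>. Counting
  letters shows that \<open>u\<close> agrees with \<open>t\<close> on at least \<open>\<delta> / 2\<close> positions of each of \<open>P\<^sub>0\<close> and \<open>P\<^sub>1\<close>.
  Since \<open>|P\<^sub>0| + |P\<^sub>1| = h\<close>, AM-GM gives \<open>|P\<^sub>0| |P\<^sub>1| \<le> h\<^sup>2 / 4\<close>. Hence both random positions are of
  this kind with probability at least \<open>(\<delta> / h)\<^sup>2\<close>, and then the exchange lowers the distance to \<open>u\<close>
  by 2. For \<open>u = s\<^sup>*\<close>, \<open>t\<close> a violated \<open>s\<^sub>i\<close> and \<open>H(x,u) \<le> 2d\<close> one has \<open>\<delta> > \<epsilon> d\<close> and \<open>h \<le> 3d\<close>, so that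
  \<open>\<delta> / h \<ge> \<epsilon> / 3\<close>. The two choices must be treated jointly: for \<open>\<epsilon> > 1\<close> a single one can succeed
  with probability below \<open>\<epsilon> / 3\<close>.\<close>

lemma card_Collect_less_eq_sum:
  "card {a. a < (m::nat) \<and> Q a} = (\<Sum>a<m. of_bool (Q a))"
  by (simp add: Int_def)

lemma hamming_commute: "length x = length y \<Longrightarrow> hamming x y = hamming y x"
  unfolding hamming_def by (metis (lifting))

lemma hamming_triangle:
  assumes "length x = length y"
  shows "hamming x z \<le> hamming x y + hamming y z"
  unfolding hamming_def card_Collect_less_eq_sum assms sum.distrib[symmetric]
  by (rule sum_mono) auto

lemma finite_P0 [simp]: "finite (P0 x t)"
  and finite_P1 [simp]: "finite (P1 x t)"
  by (auto simp: P0_def P1_def)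

lemma card_P0_add_card_P1: "card (P0 x t) + card (P1 x t) = hamming x t"
  unfolding P0_def P1_def hamming_def card_Collect_less_eq_sum sum.distrib[symmetric]
  by (rule sum.cong) auto

lemma
  assumes "length u = length x"
  shows hamming_add_ones_le_card_P0_Int:
      "hamming x t + ones u \<le> 2 * card (P0 x t \<inter> P0 x u) + hamming u t + ones x"
    and hamming_add_ones_le_card_P1_Int:
      "hamming x t + ones x \<le> 2 * card (P1 x t \<inter> P1 x u) + hamming u t + ones u"
proof -
  have inter: "P0 x t \<inter> P0 x u = {a. a < length x \<and> \<not> x ! a \<and> t ! a \<and> u ! a}"
    "P1 x t \<inter> P1 x u = {a. a < length x \<and> x ! a \<and> \<not> t ! a \<and> \<not> u ! a}"
    by (auto simp: P0_def P1_def)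
  note as_sums = inter hamming_def ones_def assms card_Collect_less_eq_sum sum.distrib[symmetric]
    sum_distrib_left
  show "hamming x t + ones u \<le> 2 * card (P0 x t \<inter> P0 x u) + hamming u t + ones x"
    unfolding as_sums by (rule sum_mono) auto
  show "hamming x t + ones x \<le> 2 * card (P1 x t \<inter> P1 x u) + hamming u t + ones u"
    unfolding as_sums by (rule sum_mono) auto
qed

abbreviation exchange :: "bool list \<Rightarrow> nat \<Rightarrow> nat \<Rightarrow> bool list" where
  "exchange x a b \<equiv> x[a := True, b := False]"

lemma exchange_in_S:
  assumes "x \<in> S k m" "a \<in> P0 x t" "b \<in> P1 x t"
  shows "exchange x a b \<in> S k m"
proof -
  let ?O = "{i. i < length x \<and> x ! i}"
  have "{i. i < length (exchange x a b) \<and> exchange x a b ! i} = insert a (?O - {b})"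
    using assms(2,3) by (auto simp: P0_def P1_def nth_list_update)
  moreover have "a \<notin> ?O" "b \<in> ?O"
    using assms(2,3) by (auto simp: P0_def P1_def)
  ultimately have "ones (exchange x a b) = ones x"
    unfolding ones_def by (simp add: card_Suc_Diff1 del: mem_Collect_eq card_Diff_insert)
  then show ?thesis using assms(1) by (simp add: S_def)
qed

lemma hamming_exchange:
  assumes "a \<in> P0 x u" "b \<in> P1 x u"
  shows "hamming (exchange x a b) u + 2 = hamming x u"
proof -
  let ?D = "{i. i < length x \<and> x ! i \<noteq> u ! i}"
  have "{i. i < length (exchange x a b) \<and> exchange x a b ! i \<noteq> u ! i} = ?D - {a, b}"
    using assms by (auto simp: P0_def P1_def nth_list_update)
  moreover have "{a, b} \<subseteq> ?D" "a \<noteq> b"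
    using assms by (auto simp: P0_def P1_def)
  moreover have "card (?D - {a, b}) + card {a, b} = card ?D"
    using card_mono[OF _ \<open>{a, b} \<subseteq> ?D\<close>] \<open>{a, b} \<subseteq> ?D\<close> by (subst card_Diff_subset) auto
  ultimately show ?thesis by (simp add: hamming_def)
qed

abbreviation uniform_exchange :: "bool list \<Rightarrow> bool list \<Rightarrow> (nat \<times> nat) pmf" where
  "uniform_exchange x t \<equiv> pair_pmf (pmf_of_set (P0 x t)) (pmf_of_set (P1 x t))"

lemma prob_uniform_exchange:
  assumes "P0 x t \<noteq> {}" "P1 x t \<noteq> {}"
  shows "measure_pmf.prob (uniform_exchange x t) (A \<times> B) =
    card (P0 x t \<inter> A) / card (P0 x t) * (card (P1 x t \<inter> B) / card (P1 x t))"
  using assms by (simp add: measure_pmf_prob_product measure_pmf_of_set)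

lemma prob_uniform_exchange_ge:
  assumes len: "length u = length x" and ones: "ones u = ones x"
    and closer: "hamming u t < hamming x t"
  shows "(1 - hamming u t / hamming x t)\<^sup>2
    \<le> measure_pmf.prob (uniform_exchange x t) (P0 x u \<times> P1 x u)"
proof -
  define h \<delta> where "h = real (hamming x t)" and "\<delta> = h - hamming u t"
  define p0 p1 where "p0 = real (card (P0 x t))" and "p1 = real (card (P1 x t))"
  define g0 g1 where "g0 = real (card (P0 x t \<inter> P0 x u))" and "g1 = real (card (P1 x t \<inter> P1 x u))"
  have "0 < \<delta>" using closer by (simp add: \<delta>_def h_def)
  have agree_ge: "\<delta> \<le> 2 * g0" "\<delta> \<le> 2 * g1"
    using hamming_add_ones_le_card_P0_Int[OF len, of t]
      hamming_add_ones_le_card_P1_Int[OF len, of t] ones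
    unfolding \<delta>_def h_def g0_def g1_def by linarith+
  have "g0 \<le> p0" "g1 \<le> p1"
    unfolding g0_def g1_def p0_def p1_def by (simp_all add: card_mono)
  with agree_ge \<open>0 < \<delta>\<close> have pos: "0 < p0" "0 < p1" by linarith+
  have "h = p0 + p1"
    using card_P0_add_card_P1[of x t] by (simp add: h_def p0_def p1_def)
  then have am_gm: "2 * p0 * (2 * p1) \<le> h\<^sup>2"
    using sum_squares_bound[of p0 p1] by (simp add: power2_sum)
  have "(1 - hamming u t / hamming x t)\<^sup>2 = (\<delta> * \<delta>) / h\<^sup>2"
    using closer by (simp add: \<delta>_def h_def power2_eq_square field_simps)
  also have "\<dots> \<le> (2 * g0 * (2 * g1)) / (2 * p0 * (2 * p1))"
    using agree_ge \<open>0 < \<delta>\<close> pos am_gm by (intro frac_le mult_mono) auto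
  also have "\<dots> = g0 / p0 * (g1 / p1)" by simp
  also have "\<dots> = measure_pmf.prob (uniform_exchange x t) (P0 x u \<times> P1 x u)"
    using pos by (subst prob_uniform_exchange) (auto simp: g0_def g1_def p0_def p1_def)
  finally show ?thesis .
qed

lemma prob_uniform_exchange_ge_if_far:
  assumes "x \<in> S k m" "u \<in> S k m"
    and near: "hamming x u \<le> 2 * d" and close: "hamming u t \<le> d"
    and far: "(1 + \<epsilon>) * real d < hamming x t" and "0 \<le> \<epsilon>"
  shows "(\<epsilon> / 3)\<^sup>2 \<le> measure_pmf.prob (uniform_exchange x t) (P0 x u \<times> P1 x u)"
proof -
  have len: "length u = length x" and ones: "ones u = ones x"
    using assms(1,2) by (auto simp: S_def)
  have at_most: "hamming x t \<le> 3 * d"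
    using hamming_triangle[of x u t] len near close by simp
  have "0 \<le> \<epsilon> * d" using \<open>0 \<le> \<epsilon>\<close> by simp
  with far have "real d < hamming x t" by (simp add: distrib_right)
  then have closer: "hamming u t < hamming x t" using close by linarith
  have "\<epsilon> * hamming x t \<le> \<epsilon> * (3 * d)"
    using at_most \<open>0 \<le> \<epsilon>\<close> by (intro mult_left_mono) linarith+
  also have "\<dots> \<le> 3 * (hamming x t - real (hamming u t))"
    using far close by (simp add: algebra_simps)
  finally have "\<epsilon> / 3 \<le> 1 - hamming u t / hamming x t"
    using closer by (simp add: field_simps)
  then have "(\<epsilon> / 3)\<^sup>2 \<le> (1 - hamming u t / hamming x t)\<^sup>2"
    using \<open>0 \<le> \<epsilon>\<close> by (intro power_mono) auto
  also note prob_uniform_exchange_ge[OF len ones closer]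
  finally show ?thesis .
qed

lemma prob_bind_pmf_ge:
  assumes "\<And>x. x \<in> set_pmf p \<Longrightarrow> x \<in> G \<Longrightarrow> c \<le> measure_pmf.prob (f x) A" "0 \<le> c"
  shows "measure_pmf.prob p G * c \<le> measure_pmf.prob (bind_pmf p f) A"
proof -
  have "ennreal (measure_pmf.prob p G * c) = (\<integral>\<^sup>+x. ennreal c * indicator G x \<partial>measure_pmf p)"
    using assms(2)
    by (simp add: nn_integral_cmult_indicator measure_pmf.emeasure_eq_measure ennreal_mult mult.commute)
  also have "\<dots> \<le> (\<integral>\<^sup>+x. emeasure (measure_pmf (f x)) A \<partial>measure_pmf p)"
    using assms by (intro nn_integral_mono_AE)
      (auto simp: AE_measure_pmf_iff indicator_def measure_pmf.emeasure_eq_measure ennreal_leI)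
  also have "\<dots> = ennreal (measure_pmf.prob (bind_pmf p f) A)"
    by (simp add: measure_pmf.emeasure_eq_measure[symmetric])
  finally show ?thesis by simp
qed

lemma not_good_approx_iff:
  assumes "n \<ge> 1"
  shows "\<not> good_approx n s d \<epsilon> x \<longleftrightarrow> (\<exists>i\<in>{1..n}. (1 + \<epsilon>) * real d < hamming x (s i))"
proof -
  have "real (MAX i\<in>{1..n}. hamming x (s i)) = (MAX i\<in>{1..n}. real (hamming x (s i)))"
    using assms by (subst mono_Max_commute) (auto simp: mono_def image_image)
  then show ?thesis
    using assms by (simp add: good_approx_def not_le Max_gr_iff)
qed

lemma valid_selectionD:
  assumes "valid_selection n s d \<epsilon> sel" "n \<ge> 1" "\<not> good_approx n s d \<epsilon> x"
  shows "sel (xs @ [x]) \<in> {1..n}" "(1 + \<epsilon>) * real d < hamming x (s (sel (xs @ [x])))"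
proof -
  have "xs @ [x] \<noteq> []" "\<exists>i\<in>{1..n}. (1 + \<epsilon>) * real d < hamming (last (xs @ [x])) (s i)"
    using assms(3) by (simp_all only: not_good_approx_iff[OF assms(2)] last_snoc) simp
  with assms(1) have "sel (xs @ [x]) \<in> {1..n} \<and>
      (1 + \<epsilon>) * real d < hamming (last (xs @ [x])) (s (sel (xs @ [x])))"
    unfolding valid_selection_def by blast
  then show "sel (xs @ [x]) \<in> {1..n}" "(1 + \<epsilon>) * real d < hamming x (s (sel (xs @ [x])))"
    by simp_all
qed

lemma mav_loop_extends:
  "r \<in> set_pmf (mav_loop n s d \<epsilon> sel i xs) \<Longrightarrow> \<exists>ys. fst r = xs @ ys"
proof (induction i arbitrary: xs)
  case 0
  then show ?case by simp
next
  case (Suc i)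
  then show ?case by (fastforce simp: Let_def split: if_splits)
qed

lemma mav_loop_Suc_eq_bind:
  assumes "\<not> good_approx n s d \<epsilon> x" "P0 x (s (sel (xs @ [x]))) \<noteq> {}" "P1 x (s (sel (xs @ [x]))) \<noteq> {}"
  shows "mav_loop n s d \<epsilon> sel (Suc i) (xs @ [x]) =
    bind_pmf (uniform_exchange x (s (sel (xs @ [x]))))
      (\<lambda>(a, b). mav_loop n s d \<epsilon> sel i (xs @ [x, exchange x a b]))"
  using assms by (simp add: Let_def min_def pair_pmf_def bind_assoc_pmf bind_return_pmf)

lemma prob_mav_loop_Suc_ge:
  assumes "n \<ge> 1" "0 \<le> \<epsilon>"
    and solution: "mav_solution m n s k d u" and selection: "valid_selection n s d \<epsilon> sel"
    and x_in_S: "x \<in> S k m" and near: "hamming x u \<le> 2 * d"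
    and not_good: "\<not> good_approx n s d \<epsilon> x"
    and nonempty: "P0 x (s (sel (xs @ [x]))) \<noteq> {}" "P1 x (s (sel (xs @ [x]))) \<noteq> {}"
    and next_ge: "\<And>y. y \<in> S k m \<Longrightarrow> hamming y u + 2 = hamming x u \<Longrightarrow>
      c \<le> measure_pmf.prob (mav_loop n s d \<epsilon> sel i (xs @ [x, y])) E"
    and "0 \<le> c"
  shows "(\<epsilon> / 3)\<^sup>2 * c \<le> measure_pmf.prob (mav_loop n s d \<epsilon> sel (Suc i) (xs @ [x])) E"
proof -
  let ?t = "s (sel (xs @ [x]))"
  note selected = valid_selectionD[OF selection \<open>n \<ge> 1\<close> not_good, of xs]
  have u_in_S: "u \<in> S k m" and close: "hamming u ?t \<le> d"
    using solution selected(1) by (auto simp: mav_solution_def)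
  have "(\<epsilon> / 3)\<^sup>2 * c \<le> measure_pmf.prob (uniform_exchange x ?t) (P0 x u \<times> P1 x u) * c"
    using prob_uniform_exchange_ge_if_far[OF x_in_S u_in_S near close selected(2) \<open>0 \<le> \<epsilon>\<close>]
      \<open>0 \<le> c\<close>
    by (rule mult_right_mono)
  also have "\<dots> \<le> measure_pmf.prob (bind_pmf (uniform_exchange x ?t)
      (\<lambda>(a, b). mav_loop n s d \<epsilon> sel i (xs @ [x, exchange x a b]))) E"
    using next_ge exchange_in_S[OF x_in_S] hamming_exchange nonempty \<open>0 \<le> c\<close>
    by (intro prob_bind_pmf_ge) auto
  also have "\<dots> = measure_pmf.prob (mav_loop n s d \<epsilon> sel (Suc i) (xs @ [x])) E"
    using mav_loop_Suc_eq_bind not_good nonempty by simp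
  finally show ?thesis .
qed

definition on_track :: "nat \<Rightarrow> bool list \<Rightarrow> nat \<Rightarrow> run set" where
  "on_track d u j = {r. created r j \<longrightarrow>
     int (hamming (created_string r j) u) \<le> 2 * int d - 2 * int j}"

lemma prob_on_track_eq_1_if_reached:
  assumes "hamming x u + 2 * length xs \<le> 2 * d"
  shows "measure_pmf.prob (mav_loop n s d \<epsilon> sel i (xs @ [x])) (on_track d u (length xs)) = 1"
proof -
  have "r \<in> on_track d u (length xs)"
    if reachable: "r \<in> set_pmf (mav_loop n s d \<epsilon> sel i (xs @ [x]))" for r
  proof -
    obtain ys where "fst r = (xs @ [x]) @ ys" using mav_loop_extends[OF reachable] by blast
    then have "created_string r (length xs) = x" by (simp add: created_string_def)
    then show ?thesis using assms by (simp add: on_track_def)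
  qed
  then show ?thesis by (simp add: measure_pmf.prob_eq_1 AE_measure_pmf_iff)
qed

lemma prob_on_track_eq_1_if_halted:
  assumes "length xs < j"
    and "i = 0 \<or> good_approx n s d \<epsilon> x \<or>
      P0 x (s (sel (xs @ [x]))) = {} \<or> P1 x (s (sel (xs @ [x]))) = {}"
  shows "measure_pmf.prob (mav_loop n s d \<epsilon> sel i (xs @ [x])) (on_track d u j) = 1"
proof -
  have "\<exists>b. mav_loop n s d \<epsilon> sel i (xs @ [x]) = return_pmf (xs @ [x], b)"
    using assms(2) by (cases i) (auto simp: Let_def)
  moreover have "(xs @ [x], b) \<in> on_track d u j" for b
    using assms(1) by (simp add: on_track_def created_def)
  ultimately show ?thesis by auto
qed

lemma prob_mav_loop_on_track_ge:
  fixes \<epsilon> :: real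
  assumes "n \<ge> 1" "0 \<le> \<epsilon>" "\<epsilon> \<le> 3" "mav_solution m n s k d u" "valid_selection n s d \<epsilon> sel"
    and "x \<in> S k m" "length xs \<le> j" "hamming x u + 2 * length xs \<le> 2 * d"
  shows "(\<epsilon> / 3) ^ (2 * (j - length xs))
    \<le> measure_pmf.prob (mav_loop n s d \<epsilon> sel i (xs @ [x])) (on_track d u j)"
  using assms(6-)
proof (induction "j - length xs" arbitrary: i xs x)
  case 0
  then have "j = length xs" by simp
  then show ?case using prob_on_track_eq_1_if_reached[OF 0(4)] by simp
next
  case (Suc l)
  let ?t = "s (sel (xs @ [x]))"
  show ?case
  proof (cases "i = 0 \<or> good_approx n s d \<epsilon> x \<or> P0 x ?t = {} \<or> P1 x ?t = {}")
    case True
    then have "measure_pmf.prob (mav_loop n s d \<epsilon> sel i (xs @ [x])) (on_track d u j) = 1"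
      using Suc.hyps(2) by (intro prob_on_track_eq_1_if_halted) simp_all
    then show ?thesis using assms(2,3) by (simp add: power_le_one)
  next
    case False
    then obtain i' where i_eq: "i = Suc i'" by (cases i) auto
    have l_eq: "l = j - length (xs @ [x])" and bound: "length (xs @ [x]) \<le> j"
      using Suc.hyps(2) by simp_all
    have "(\<epsilon> / 3) ^ (2 * l)
        \<le> measure_pmf.prob (mav_loop n s d \<epsilon> sel i' (xs @ [x, y])) (on_track d u j)"
      if "y \<in> S k m" "hamming y u + 2 = hamming x u" for y
      using Suc.hyps(1)[OF l_eq that(1) bound, of i'] Suc.prems(3) that(2) l_eq by simp
    then have "(\<epsilon> / 3)\<^sup>2 * (\<epsilon> / 3) ^ (2 * l)
        \<le> measure_pmf.prob (mav_loop n s d \<epsilon> sel i (xs @ [x])) (on_track d u j)"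
      unfolding i_eq using Suc.prems(3) False assms(2)
      by (intro prob_mav_loop_Suc_ge[OF assms(1,2,4,5) Suc.prems(1)]) auto
    moreover have "2 * (j - length xs) = 2 + 2 * l"
      using Suc.hyps(2) by simp
    ultimately show ?thesis by (simp only: power_add)
  qed
qed

lemma hamming_k_completion_solution_le:
  assumes "k_completion k t x" "\<bar>int (ones t) - int k\<bar> \<le> int d"
    and "length u = length t" "hamming u t \<le> d"
  shows "hamming x u \<le> 2 * d"
proof -
  have "length x = length t" "hamming t x \<le> d"
    using assms(1,2) by (auto simp: k_completion_def S_def)
  then show ?thesis
    using hamming_triangle[of x t u] hamming_commute[of x t] hamming_commute[of u t] assms(3,4)
    by simp
qed

theorem corollary1:
  fixes m n k d j :: nat and s :: "nat \<Rightarrow> bool list" and \<epsilon> :: real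
    and x0 sstar :: "bool list" and sel :: "bool list list \<Rightarrow> nat"
  assumes "n \<ge> 1"
    and "\<forall>i\<in>{1..n}. length (s i) = m"
    and "0 < \<epsilon>" and "\<epsilon> < 3"
    and "mav_solution m n s k d sstar"
    and "k_completion k (s 1) x0"
    and "valid_selection n s d \<epsilon> sel"
    and "j \<le> d"
  shows "measure_pmf.prob (mav_algorithm n s k d \<epsilon> x0 sel)
           {r. created r j \<longrightarrow>
               int (hamming (created_string r j) sstar) \<le> 2 * int d - 2 * int j}
         \<ge> (\<epsilon> / 3) ^ (2 * j)"
proof (cases "\<bar>int (ones (s 1)) - int k\<bar> > int d")
  case True
  then show ?thesis using assms(3,4)
    by (simp add: mav_algorithm_def created_def power_le_one)
next
  case False
  have "length sstar = length (s 1)" "hamming sstar (s 1) \<le> d"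
    using assms(1,2,5) by (auto simp: mav_solution_def S_def)
  then have "hamming x0 sstar \<le> 2 * d"
    using hamming_k_completion_solution_le assms(6) False by (meson not_le)
  moreover have "x0 \<in> S k m"
    using assms(1,2,6) by (auto simp: k_completion_def)
  ultimately have "(\<epsilon> / 3) ^ (2 * j)
      \<le> measure_pmf.prob (mav_loop n s d \<epsilon> sel d [x0]) (on_track d sstar j)"
    using prob_mav_loop_on_track_ge[OF assms(1) _ _ assms(5,7), of x0 "[]" j d] assms(3,4) by simp
  then show ?thesis
    using False by (simp add: mav_algorithm_def on_track_def)
qed

end
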